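(* For every real $m>0$, the function $f:(0,\infty)\to\mathbb{R}$ given by \[ f(x)=\psi'(x+1)-\frac{1}{m}\sinh\frac{m}{x+1} \] is not completely monotonic.
   Context: An infinitely differentiable function $f:(0,\infty)\to\mathbb{R}$ is called completely monotonic if $(-1)^n f^{(n)}(x)\ge 0$ for all $x>0$ and all $n=0,1,2,\dots$ (where $f^{(0)}=f$). Here $\psi(x)=\Gamma'(x)/\Gamma(x)$, $x>0$, is the digamma function, where $\Gamma$ is Euler's gamma function, and $\psi'$ is the derivative of $\psi$. *)

theory Defs
  imports "HOL-Analysis.Analysis"
begin

text \<open>
  A function on the open half-line is modelled by a total function on the reals. Since the
  half-line is open, the iterated \<^const>\<open>deriv\<close> at a point x > 0 depends only on the values of f
  on the half-line; what f does elsewhere is irrelevant. Differentiability of every iterate is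
  required explicitly because \<^const>\<open>deriv\<close> is total.
\<close>

definition completely_monotonic :: "(real \<Rightarrow> real) \<Rightarrow> bool" where
  "completely_monotonic f \<longleftrightarrow>
     (\<forall>n. \<forall>x>0. (deriv ^^ n) f differentiable (at x)) \<and>
     (\<forall>n. \<forall>x>0. (-1) ^ n * (deriv ^^ n) f x \<ge> 0)"

end

theory Submission
  imports Defs
begin

text \<open>
  Writing y = 1/(x+1), the second term of the function is the power series in y with coefficients
  m^(k-1)/k! for odd k, and all of its signed derivatives are again power series in y with
  nonnegative coefficients. Its y^3 term alone makes the signed n-th derivative at x = 1 at least
  m^2 (n+2)! / (12 \<sqdot> 2^(n+3)), whereas that of the trigamma term is at most C (n+1)! / 2^n with
  C independent of n. For large n the former is bigger.
\<close>

text \<open>Openness is the point: the induction hypothesis equates the iterate with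
  \<open>G n\<close> on \<open>S\<close> only, and an equality on an open set carries over to
  derivatives there.\<close>

lemma funpow_deriv_eq:
  fixes G :: "nat \<Rightarrow> 'a :: real_normed_field \<Rightarrow> 'a"
  assumes "open S"
    and "\<And>x. x \<in> S \<Longrightarrow> G 0 x = f x"
    and "\<And>n x. x \<in> S \<Longrightarrow> (G n has_field_derivative G (Suc n) x) (at x)"
    and "x \<in> S"
  shows "(deriv ^^ n) f x = G n x"
  using \<open>x \<in> S\<close>
proof (induction n arbitrary: x)
  case 0
  then show ?case using assms(2) by simp
next
  case (Suc n)
  have "((deriv ^^ n) f has_field_derivative G (Suc n) x) (at x)"
    using has_field_derivative_transform_within_open[OF assms(3)[OF Suc.prems] assms(1) Suc.prems]
      Suc.IH by simp
  then show ?case by (simp add: DERIV_imp_deriv)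
qed

text \<open>
  Coefficients of -d/dx applied to the series with coefficients c in the variable y = 1/(x+1).
  Truncated subtraction makes the entries at k = 0 and k = 1 vanish, as they should.
\<close>
definition recip_diffs :: "(nat \<Rightarrow> real) \<Rightarrow> nat \<Rightarrow> real" where
  "recip_diffs c k = real (k - 1) * c (k - 1)"

text \<open>Chain rule: for y = 1/(x+1) one has dy/dx = -y^2, so -d/dx of a series in y is y^2 times
  its y-derivative, and the factor y^2 moves every coefficient up by two places.\<close>

lemma recip_diffs_sums:
  assumes "\<And>y. summable (\<lambda>k. c k * y ^ k)"
  shows "(\<lambda>k. recip_diffs c k * y ^ k) sums (y\<^sup>2 * (\<Sum>k. diffs c k * y ^ k))"
proof -
  have "(\<lambda>k. y\<^sup>2 * (diffs c k * y ^ k)) sums (y\<^sup>2 * (\<Sum>k. diffs c k * y ^ k))"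
    by (intro sums_mult summable_sums termdiff_converges_all assms)
  also have "(\<lambda>k. y\<^sup>2 * (diffs c k * y ^ k)) = (\<lambda>k. recip_diffs c (k + 2) * y ^ (k + 2))"
    by (simp add: recip_diffs_def diffs_def power2_eq_square algebra_simps)
  finally show ?thesis
    by (subst (asm) sums_iff_shift) (simp add: recip_diffs_def numeral_2_eq_2)
qed

lemma summable_funpow_recip_diffs:
  assumes "\<And>y. summable (\<lambda>k. c k * y ^ k)"
  shows "summable (\<lambda>k. (recip_diffs ^^ n) c k * y ^ k)"
proof (induction n arbitrary: y)
  case (Suc n)
  then show ?case using recip_diffs_sums[of "(recip_diffs ^^ n) c" y] by (auto simp: sums_iff)
qed (use assms in simp)

lemma has_field_derivative_recip_series:
  fixes x :: real
  assumes "\<And>y. summable (\<lambda>k. c k * y ^ k)" and "x > -1"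
  shows "((\<lambda>x. \<Sum>k. c k * (1 / (x + 1)) ^ k) has_field_derivative
           - (\<Sum>k. recip_diffs c k * (1 / (x + 1)) ^ k)) (at x)"
proof -
  have "((\<lambda>x. 1 / (x + 1)) has_field_derivative - ((1 / (x + 1))\<^sup>2)) (at x)"
    using assms(2) by (auto intro!: derivative_eq_intros simp: power2_eq_square)
  from DERIV_chain2[OF termdiffs_strong_converges_everywhere[OF assms(1)] this]
  have "((\<lambda>x. \<Sum>k. c k * (1 / (x + 1)) ^ k) has_field_derivative
           (\<Sum>k. diffs c k * (1 / (x + 1)) ^ k) * - ((1 / (x + 1))\<^sup>2)) (at x)" .
  then show ?thesis
    using sums_unique[OF recip_diffs_sums[OF assms(1), where y = "1 / (x + 1)"]]
    by (simp add: mult.commute)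
qed

lemma funpow_recip_diffs_nonneg:
  assumes "\<And>k. c k \<ge> 0"
  shows "(recip_diffs ^^ n) c k \<ge> 0"
  using assms by (induction n arbitrary: k) (auto simp: recip_diffs_def)

text \<open>Each step moves a coefficient up by one index and multiplies it by the index it leaves,
  so \<open>c 3\<close> collects 3 * 4 * ... * (n+2) = (n+2)!/2.\<close>

lemma funpow_recip_diffs_add_3: "(recip_diffs ^^ n) c (n + 3) = c 3 * fact (n + 2) / 2"
  by (induction n) (simp_all add: recip_diffs_def eval_nat_numeral algebra_simps)

definition sinh_coeff :: "real \<Rightarrow> nat \<Rightarrow> real" where
  "sinh_coeff m k = (if even k then 0 else m ^ (k - 1) / fact k)"

lemma sinh_coeff_sums:
  assumes "m \<noteq> 0"
  shows "(\<lambda>k. sinh_coeff m k * y ^ k) sums (1 / m * sinh (m * y))"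
proof -
  have "1 / m * (if even k then 0 else (m * y) ^ k /\<^sub>R fact k) = sinh_coeff m k * y ^ k" for k
    using assms
    by (cases k) (auto simp: sinh_coeff_def power_mult_distrib divide_simps)
  with sums_mult[OF sinh_converges[of "m * y"], of "1 / m"] show ?thesis by simp
qed

text \<open>Of the n + 2 factors 1/(2+k), n are bounded by 1/2 each; the two that remain keep the
  sum convergent. This controls \<open>Polygamma (Suc n)\<close> at 2.\<close>

lemma suminf_inverse_power_le:
  "(\<Sum>k. inverse ((2 + real k) ^ (n + 2))) \<le> (\<Sum>k. inverse ((2 + real k)\<^sup>2)) / 2 ^ n"
proof -
  have s: "summable (\<lambda>k. inverse ((2 + real k) ^ j))" if "j \<ge> 2" for j
    using Polygamma_converges'[of "2 :: real" j] that by simp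
  have le: "inverse ((2 + real k) ^ (n + 2)) \<le> inverse ((2 + real k)\<^sup>2) / 2 ^ n" for k
  proof -
    have "inverse ((2 + real k) ^ n) \<le> inverse (2 ^ n)"
      by (intro le_imp_inverse_le power_mono) auto
    then have "inverse ((2 + real k)\<^sup>2) * inverse ((2 + real k) ^ n)
        \<le> inverse ((2 + real k)\<^sup>2) * inverse (2 ^ n)"
      by (intro mult_left_mono) auto
    then show ?thesis by (simp only: power_add inverse_mult_distrib divide_inverse mult.commute)
  qed
  have "(\<Sum>k. inverse ((2 + real k) ^ (n + 2))) \<le> (\<Sum>k. inverse ((2 + real k)\<^sup>2) / 2 ^ n)"
    by (intro suminf_le le s summable_divide) auto
  also have "\<dots> = (\<Sum>k. inverse ((2 + real k)\<^sup>2)) / 2 ^ n"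
    by (intro suminf_divide s) auto
  finally show ?thesis .
qed

theorem proposition3p1:
  fixes m :: real
  assumes "m > 0"
  shows "\<not> completely_monotonic
           (\<lambda>x. deriv Digamma (x + 1) - (1 / m) * sinh (m / (x + 1)))"
proof
  define c where "c = sinh_coeff m"
  define f where "f = (\<lambda>x. deriv Digamma (x + 1) - (1 / m) * sinh (m / (x + 1)))"
  \<comment> \<open>\<open>H n\<close> is to be (-1)^n times the n-th derivative of the sinh term,
    and \<open>G n\<close> the n-th derivative of \<open>f\<close>. The order is
    \<open>Suc n\<close> because \<open>f\<close> starts from psi', which is
    \<open>Polygamma 1\<close>.\<close>
  define H where "H n x = (\<Sum>k. (recip_diffs ^^ n) c k * (1 / (x + 1)) ^ k)" for n and x :: real
  define G where "G n x = Polygamma (Suc n) (x + 1) - (-1) ^ n * H n x" for n and x :: real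
  assume "completely_monotonic (\<lambda>x. deriv Digamma (x + 1) - (1 / m) * sinh (m / (x + 1)))"
  then have cm: "(-1) ^ n * (deriv ^^ n) f 1 \<ge> 0" for n
    unfolding completely_monotonic_def f_def by simp
  have c_sums: "(\<lambda>k. c k * y ^ k) sums (1 / m * sinh (m * y))" for y
    unfolding c_def using assms by (intro sinh_coeff_sums) simp
  then have c_summable: "summable (\<lambda>k. c k * y ^ k)" for y
    by (rule sums_summable)
  have c_nonneg: "c k \<ge> 0" for k
    using assms by (simp add: c_def sinh_coeff_def)
  have not_nonpos_Int: "x + 1 \<notin> \<int>\<^sub>\<le>\<^sub>0" if "x > 0" for x :: real
    using that by (auto elim!: nonpos_Ints_cases)

  have G_0: "G 0 x = f x" if "x > 0" for x
    using sums_unique[OF c_sums[of "1 / (x + 1)"]]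
    by (simp add: G_def H_def f_def deriv_Polygamma[OF not_nonpos_Int[OF that]])
  have G_deriv: "(G n has_field_derivative G (Suc n) x) (at x)" if "x > 0" for n x
  proof -
    have H: "(H n has_field_derivative - H (Suc n) x) (at x)"
      unfolding H_def funpow.simps comp_apply using that
      by (intro has_field_derivative_recip_series summable_funpow_recip_diffs c_summable) auto
    have "((\<lambda>x. Polygamma (Suc n) (x + 1)) has_field_derivative
             Polygamma (Suc (Suc n)) (x + 1)) (at x)"
      by (auto intro!: derivative_eq_intros not_nonpos_Int that)
    from DERIV_diff[OF this DERIV_cmult[OF H, of "(-1) ^ n"]] show ?thesis
      unfolding G_def by simp
  qed
  have f_deriv: "(deriv ^^ n) f 1 = G n 1" for n
    by (rule funpow_deriv_eq[where S = "{0<..}"]) (use G_0 G_deriv in auto)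

  define C where "C = (\<Sum>k. inverse ((2 + real k)\<^sup>2))"
  have bound: "m\<^sup>2 * real (n + 2) \<le> 96 * C" for n
  proof -
    \<comment> \<open>The series \<open>H n 1\<close>, taken at y = 1/2, has nonnegative terms, so
      its single term k = n + 3 bounds it from below; m^2/6 is \<open>c 3\<close>.\<close>
    have "m\<^sup>2 / 6 * fact (n + 2) / 2 * (1 / 2) ^ (n + 3)
        = (\<Sum>k\<in>{n + 3}. (recip_diffs ^^ n) c k * (1 / (1 + 1)) ^ k)"
      by (simp add: funpow_recip_diffs_add_3 del: fact_Suc)
         (simp add: c_def sinh_coeff_def fact_numeral)
    also have "\<dots> \<le> H n 1"
      unfolding H_def
      by (intro sum_le_suminf summable_funpow_recip_diffs c_summable)
         (auto intro!: mult_nonneg_nonneg funpow_recip_diffs_nonneg c_nonneg)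
    \<comment> \<open>Complete monotonicity enters here: in (-1)^n \<open>G n 1\<close> \<ge> 0 the
      two signs in front of \<open>H n 1\<close> cancel.\<close>
    also have "H n 1 \<le> (-1) ^ n * Polygamma (Suc n) (2 :: real)"
      using cm[of n] by (simp add: f_deriv G_def right_diff_distrib flip: mult.assoc power_mult_distrib)
    also have "\<dots> = fact (n + 1) * (\<Sum>k. inverse ((2 + real k) ^ (n + 2)))"
      by (simp add: Polygamma_def del: fact_Suc flip: mult.assoc power_mult_distrib)
    also have "\<dots> \<le> fact (n + 1) * (C / 2 ^ n)"
      unfolding C_def by (intro mult_left_mono suminf_inverse_power_le) auto
    \<comment> \<open>The powers 2^n cancel, leaving 96 = 6 * 2 * 2^3; the surplus factor n + 2
      comes from (n+2)! = (n+2) (n+1)!.\<close>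
    finally have "fact (n + 1) * (m\<^sup>2 * real (n + 2)) \<le> fact (n + 1) * (96 * C)"
      by (simp add: power_add power_one_over divide_simps mult_ac fact_reduce del: fact_Suc)
    then show ?thesis
      by (simp only: mult_le_cancel_left_pos fact_gt_zero)
  qed
  obtain n where "96 * C < real n * m\<^sup>2"
    using reals_Archimedean3[of "m\<^sup>2"] assms by auto
  moreover have "real n * m\<^sup>2 \<le> m\<^sup>2 * real (n + 2)"
    by (simp add: algebra_simps)
  ultimately show False using bound[of n] by linarith
qed

end
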